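(* Let $k\ge 2$ be an integer, and let $n=m(k+1)$ for some integer $m\ge 9$. Then a best monotone $1/k$-tough theorem for $n$-sequences whose degree conditions consist solely of weakly optimal Chvátal-type conditions requires at least $\dfrac{p(k-1)\,n}{5(k+1)}$ such conditions, where $p(r)$ denotes the integer partition function.
   Context: All graphs are finite and simple. An $n$-sequence is an integer sequence $\pi=(d_1\le d_2\le\dots\le d_n)$, written in nondecreasing order, with $0\le d_j\le n-1$ for all $j$. It is graphical (a "degree sequence") if it is the sequence of vertex degrees of some graph $G$, called a realization of $\pi$. For two $n$-sequences $\pi=(d_j)$, $\pi'=(d'_j)$, $\pi'$ majorizes $\pi$, written $\pi'\ge\pi$, if $d'_j\ge d_j$ for all $j$. $\omega(G)$ is the number of components of a graph $G$. For $t\ge0$, $G$ is $t$-tough if $t\cdot\omega(G-X)\le|X|$ for every $X\subseteq V(G)$ with $\omega(G-X)>1$. A graphical sequence is forcibly $1/k$-tough if every realization of it is $1/k$-tough. A Chvátal-type condition for $n$-sequences $(d_1\le\dots\le d_n)$ is a condition of the form $d_{i_1}\ge k_{i_1}\vee d_{i_2}\ge k_{i_2}\vee\dots\vee d_{i_r}\ge k_{i_r}$, where all $i_j$ and $k_{i_j}$ are integers, $1\le i_1<i_2<\dots<i_r\le n$ and $1\le k_{i_1}\le k_{i_2}\le\dots\le k_{i_r}\le n$. Such a condition $c$ is weakly optimal (for the property of being $1/k$-tough) if every $n$-sequence, not necessarily graphical, which does not satisfy $c$ is majorized by a degree sequence which is not forcibly $1/k$-tough. A $1/k$-tough theorem for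 $n$-sequences is a (true) theorem declaring certain degree sequences of length $n$ to be forcibly $1/k$-tough and making no decision on the others; when its degree conditions form a set of Chvátal-type conditions, it declares forcibly $1/k$-tough exactly the sequences satisfying all conditions in the set. It is monotone if, whenever it declares $\pi$ forcibly $1/k$-tough and $\pi'\ge\pi$ (both degree sequences), it declares $\pi'$ forcibly $1/k$-tough. It is weakly optimal if every $n$-sequence (not necessarily graphical) which it does not declare forcibly $1/k$-tough is majorized by a degree sequence which is not forcibly $1/k$-tough. It is best monotone if it is both monotone and weakly optimal. The integer partition function $p(r)$ counts the number of ways a positive integer $r$ can be written as a sum of positive integers (order being irrelevant). *)

theory Defs
  imports Complex_Main "HOL-Library.Multiset" "Graph_Theory.Graph_Theory"
begin

text \<open>
  A finite simple graph is a \<^locale>\<open>pair_graph\<close>: finite, loop-free, with a symmetric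
  arc relation. So the degree of a vertex is its out-degree, and the components are
  the strongly connected components.
\<close>

definition num_components :: "('a, 'b) pre_digraph \<Rightarrow> nat" where
  "num_components G = card (pre_digraph.sccs_verts G)"

definition tough :: "real \<Rightarrow> 'a pair_pre_digraph \<Rightarrow> bool" where
  "tough t G \<longleftrightarrow>
    (\<forall>X \<subseteq> pverts G.
      let H = with_proj G \<restriction> (pverts G - X)
      in num_components H > 1 \<longrightarrow> t * real (num_components H) \<le> real (card X))"

definition degree_sequence :: "'a pair_pre_digraph \<Rightarrow> nat list" where
  "degree_sequence G =
    sorted_list_of_multiset (image_mset (out_degree (with_proj G)) (mset_set (pverts G)))"

text \<open>The term \<open>d\<^sub>i\<close> of a sequence (counted from 1) is \<open>\<pi> ! (i - 1)\<close>.\<close>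

definition nsequences :: "nat \<Rightarrow> nat list set" where
  "nsequences n = {\<pi>. length \<pi> = n \<and> sorted \<pi> \<and> (\<forall>d \<in> set \<pi>. d \<le> n - 1)}"

text \<open>
  Every finite graph is isomorphic to one whose vertices are natural numbers, so
  realizations are taken over the vertex type \<^typ>\<open>nat\<close>.
\<close>

definition realizes :: "nat pair_pre_digraph \<Rightarrow> nat list \<Rightarrow> bool" where
  "realizes G \<pi> \<longleftrightarrow> pair_graph G \<and> degree_sequence G = \<pi>"

definition graphical :: "nat list \<Rightarrow> bool" where
  "graphical \<pi> \<longleftrightarrow> (\<exists>G. realizes G \<pi>)"

definition majorizes :: "nat list \<Rightarrow> nat list \<Rightarrow> bool" where
  "majorizes \<pi>' \<pi> \<longleftrightarrow> list_all2 (\<le>) \<pi> \<pi>'"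

text \<open>Vacuously true of a sequence that is not graphical; only used for graphical ones.\<close>

definition forcibly_tough :: "real \<Rightarrow> nat list \<Rightarrow> bool" where
  "forcibly_tough t \<pi> \<longleftrightarrow> (\<forall>G. realizes G \<pi> \<longrightarrow> tough t G)"

definition majorized_by_nontough :: "real \<Rightarrow> nat list \<Rightarrow> bool" where
  "majorized_by_nontough t \<pi> \<longleftrightarrow>
    (\<exists>\<pi>'. graphical \<pi>' \<and> \<not> forcibly_tough t \<pi>' \<and> majorizes \<pi>' \<pi>)"

text \<open>
  The list \<open>[(i\<^sub>1, k\<^sub>1), \<dots>, (i\<^sub>r, k\<^sub>r)]\<close> stands for the condition
  \<open>d\<^bsub>i\<^sub>1\<^esub> \<ge> k\<^sub>1 \<or> \<dots> \<or> d\<^bsub>i\<^sub>r\<^esub> \<ge> k\<^sub>r\<close>.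
\<close>

type_synonym degree_condition = "(nat \<times> nat) list"

definition chvatal_conditions :: "nat \<Rightarrow> degree_condition set" where
  "chvatal_conditions n = {c. c \<noteq> [] \<and>
     sorted_wrt (<) (map fst c) \<and> sorted (map snd c) \<and>
     (\<forall>(i, k) \<in> set c. 1 \<le> i \<and> i \<le> n \<and> 1 \<le> k \<and> k \<le> n)}"

definition satisfies :: "nat list \<Rightarrow> degree_condition \<Rightarrow> bool" where
  "satisfies \<pi> c \<longleftrightarrow> (\<exists>(i, k) \<in> set c. \<pi> ! (i - 1) \<ge> k)"

definition weakly_optimal_condition :: "real \<Rightarrow> nat \<Rightarrow> degree_condition \<Rightarrow> bool" where
  "weakly_optimal_condition t n c \<longleftrightarrow>
    (\<forall>\<pi> \<in> nsequences n. \<not> satisfies \<pi> c \<longrightarrow> majorized_by_nontough t \<pi>)"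

text \<open>
  A toughness theorem is identified with the set \<open>D\<close> of \<open>n\<close>-sequences it declares forcibly
  tough. Weak optimality ranges over all \<open>n\<close>-sequences, graphical or not, so \<open>D\<close> has to contain
  the non-graphical sequences that meet the degree conditions: if \<open>D\<close> consisted of graphical
  sequences only, no theorem would be weakly optimal, since for example
  \<open>(n - 2, n - 1, \<dots>, n - 1)\<close> is not graphical and is majorized by no degree sequence
  other than that of the complete graph. Truth and monotonicity concern graphical sequences.
\<close>

definition tough_theorem :: "real \<Rightarrow> nat \<Rightarrow> nat list set \<Rightarrow> bool" where
  "tough_theorem t n D \<longleftrightarrow>
    D \<subseteq> nsequences n \<and> (\<forall>\<pi> \<in> D. graphical \<pi> \<longrightarrow> forcibly_tough t \<pi>)"

definition monotone_theorem :: "nat list set \<Rightarrow> bool" where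
  "monotone_theorem D \<longleftrightarrow>
    (\<forall>\<pi> \<pi>'. \<pi> \<in> D \<and> graphical \<pi> \<and> graphical \<pi>' \<and> majorizes \<pi>' \<pi> \<longrightarrow> \<pi>' \<in> D)"

definition weakly_optimal_theorem :: "real \<Rightarrow> nat \<Rightarrow> nat list set \<Rightarrow> bool" where
  "weakly_optimal_theorem t n D \<longleftrightarrow>
    (\<forall>\<pi> \<in> nsequences n. \<pi> \<notin> D \<longrightarrow> majorized_by_nontough t \<pi>)"

definition best_monotone_theorem :: "real \<Rightarrow> nat \<Rightarrow> nat list set \<Rightarrow> bool" where
  "best_monotone_theorem t n D \<longleftrightarrow>
    tough_theorem t n D \<and> monotone_theorem D \<and> weakly_optimal_theorem t n D"

definition declared_by :: "nat \<Rightarrow> degree_condition set \<Rightarrow> nat list set" where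
  "declared_by n C = {\<pi> \<in> nsequences n. \<forall>c \<in> C. satisfies \<pi> c}"

definition num_partitions :: "nat \<Rightarrow> nat" where
  "num_partitions r = card {M :: nat multiset. 0 \<notin># M \<and> \<Sum>\<^sub># M = r}"

text \<open>Cardinalities of sets of Chvatal-type conditions are never those of infinite sets.\<close>

lemma finite_chvatal_conditions: "finite (chvatal_conditions n)"
proof (rule finite_subset)
  show "chvatal_conditions n \<subseteq>
      {c. set c \<subseteq> {1..n} \<times> {1..n} \<and> length c \<le> n}"
  proof
    fix c assume c: "c \<in> chvatal_conditions n"
    then have "distinct (map fst c)"
      using strict_sorted_iff[of "map fst c"] by (simp add: chvatal_conditions_def)
    then have "length c = card (fst ` set c)"
      by (metis distinct_card length_map set_map)
    also have "\<dots> \<le> card {1..n}"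
      using c by (intro card_mono) (auto simp: chvatal_conditions_def)
    finally show "c \<in> {c. set c \<subseteq> {1..n} \<times> {1..n} \<and> length c \<le> n}"
      using c by (auto simp: chvatal_conditions_def)
  qed
  show "finite {c. set c \<subseteq> {1..n} \<times> {1..n} \<and> length c \<le> n}"
    by (rule finite_lists_length_le) simp
qed

end

theory Submission
  imports Defs "HOL-Library.Nat_Bijection"
begin

text \<open>
  The bound counts degree sequences that must violate pairwise different conditions. Every
  degree sequence that is not forcibly \<open>1 / k\<close>-tough violates some condition in \<open>C\<close>. A
  Chvatal-type condition is a disjunction of lower bounds, so if two sequences violate it, then so
  does their termwise maximum (\<open>seq_max_not_satisfies\<close>), and weak optimality provides a
  degree sequence that is not forcibly tough and majorizes both. Hence it suffices to find many such
  sequences, no two of which are majorized by a common degree sequence that is not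
  forcibly tough.

  For \<open>1 \<le> j \<le> m - 2\<close> and a partition \<open>lam\<close> of \<open>k - 1\<close> take the join of \<open>K\<^sub>j\<close> with \<open>k j + 1\<close>
  disjoint cliques: a clique on \<open>a + 1\<close> vertices for every part \<open>a\<close> of \<open>lam\<close>, single vertices
  that bring the number of small cliques to \<open>k j\<close>, and one large clique on the remaining
  vertices. Deleting \<open>K\<^sub>j\<close>
  shows that it is not \<open>1 / k\<close>-tough (\<open>nontough_graph_exists\<close>). This gives
  \<open>(m - 2) p(k - 1)\<close> sequences, and \<open>m - 2 \<ge> m / 5\<close>.

  Now let some degree sequence that is not forcibly tough majorize the sequence for \<open>(j, lam)\<close>. One of
  its realizations has a set of \<open>x\<close> vertices whose deletion leaves more than \<open>k x\<close> components,
  and its degrees are at most those of the join of \<open>K\<^sub>x\<close> with cliques on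
  these components (\<open>nontough_graph_join_count\<close>). The vertices of high degree
  force \<open>x = j\<close> and one component at least as large as the large clique. What is left is a
  comparison between the small components and the cliques given by \<open>lam\<close>, in which
  the number of vertices of degree at least \<open>j + t\<close> is compared for every \<open>t \<ge> 1\<close>. With the
  weights \<open>1 / (t (t + 1))\<close> these numbers sum to the total of the parts, which is at most
  \<open>k - 1\<close>, so equality holds throughout and the components determine \<open>lam\<close>
  (\<open>part_count_rigid\<close>, \<open>join_count_determines\<close>).
\<close>

section \<open>Partitions are determined by weighted vertex counts\<close>

text \<open>
  A part \<open>a\<close> stands for a clique on \<open>a + 1\<close> vertices, whose vertices have degree \<open>a\<close> inside
  it. So this is the number of vertices of degree at least \<open>t\<close> in the disjoint union of the
  cliques for the parts of \<open>M\<close>.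
\<close>

definition part_count :: "nat multiset \<Rightarrow> nat \<Rightarrow> nat" where
  "part_count M t = \<Sum>\<^sub># (image_mset Suc (filter_mset (\<lambda>a. t \<le> a) M))"

lemma part_count_empty [simp]: "part_count {#} t = 0"
  by (simp add: part_count_def)

lemma part_count_add_mset [simp]:
  "part_count (add_mset a M) t = (if t \<le> a then Suc a else 0) + part_count M t"
  by (simp add: part_count_def)

lemma sum_inverse_pronic: "(\<Sum>t=1..a. 1 / (real t * (real t + 1))) = real a / (real a + 1)"
proof (induction a)
  case (Suc a)
  have "(\<Sum>t=1..Suc a. 1 / (real t * (real t + 1)))
      = real a / (real a + 1) + 1 / ((real a + 1) * (real a + 2))"
    using Suc by (simp add: algebra_simps)
  also have "\<dots> = real (Suc a) / (real (Suc a) + 1)"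
    by (simp add: divide_simps) (simp add: algebra_simps)
  finally show ?case .
qed simp

text \<open>
  The weight of \<open>t\<close> is chosen so that a clique contributes exactly its part: part \<open>a\<close> counts
  \<open>a + 1\<close> for every \<open>t \<le> a\<close>, and the weights up to \<open>a\<close> telescope to \<open>a / (a + 1)\<close>. The
  number that is partitioned thus becomes a positive combination of vertex counts.
\<close>

lemma weighted_sum_part_count:
  assumes "\<forall>a\<in>#M. a \<le> T"
  shows "(\<Sum>t=1..T. real (part_count M t) / (real t * (real t + 1))) = real (\<Sum>\<^sub># M)"
  using assms
proof (induction M)
  case (add a M)
  have "(\<Sum>t=1..T. real (if t \<le> a then Suc a else 0) / (real t * (real t + 1)))
      = (\<Sum>t=1..a. (real a + 1) * (1 / (real t * (real t + 1))))"
    using add.prems by (intro sum.mono_neutral_cong_right) auto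
  also have "\<dots> = real a"
    by (subst sum_distrib_left[symmetric], subst sum_inverse_pronic) simp
  finally have "(\<Sum>t=1..T. real (if t \<le> a then Suc a else 0) / (real t * (real t + 1))) = real a" .
  then show ?case
    using add by (simp add: add_divide_distrib sum.distrib)
qed simp

lemma part_count_rec: "part_count M t = Suc t * count M t + part_count M (Suc t)"
  by (induction M) auto

lemma part_count_eq_0: "\<forall>a\<in>#M. a < t \<Longrightarrow> part_count M t = 0"
  by (induction M) auto

lemma part_count_filter_pos: "t \<ge> 1 \<Longrightarrow> part_count (filter_mset (\<lambda>a. 0 < a) M) t = part_count M t"
  by (induction M) auto

lemma multiset_eqI_part_count:
  assumes eq: "\<And>t. t \<in> {1..T} \<Longrightarrow> part_count M t = part_count M' t"
    and M: "\<forall>a\<in>#M. a \<le> T" "0 \<notin># M" and M': "\<forall>a\<in>#M'. a \<le> T" "0 \<notin># M'"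
  shows "M = M'"
proof (rule multiset_eqI)
  fix t
  have eq': "part_count M s = part_count M' s" if "s \<ge> 1" for s
  proof (cases "s \<le> T")
    case False
    then show ?thesis
      using M M' by (metis le_less_trans not_le part_count_eq_0)
  qed (use eq that in auto)
  show "count M t = count M' t"
  proof (cases "t = 0")
    case True
    then show ?thesis using M M' by (simp add: not_in_iff)
  next
    case False
    then have "Suc t * count M t = Suc t * count M' t"
      using part_count_rec[of M t] part_count_rec[of M' t] eq'[of t] eq'[of "Suc t"] by linarith
    then show ?thesis by (simp only: mult_cancel1) simp
  qed
qed

text \<open>
  The rigidity of partitions. Here \<open>e\<close> is the number of vertices that have been moved from
  the small cliques into the large one, where they have high degree and so help at
  every \<open>t\<close>. Weighting the inequalities bounds the loss \<open>e\<close> in the sum of the parts by the gain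
  \<open>e T / (T + 1)\<close>, which is too small unless \<open>e = 0\<close>; then the weighted sums agree, so
  all counts do, and the counts determine the nonzero parts.
\<close>

lemma part_count_rigid:
  assumes lam: "\<forall>a\<in>#lam. a \<le> T" "0 \<notin># lam" and M: "\<forall>a\<in>#M. a \<le> T"
    and sum: "\<Sum>\<^sub># M + e \<le> \<Sum>\<^sub># lam"
    and le: "\<And>t. t \<in> {1..T} \<Longrightarrow> part_count lam t \<le> part_count M t + e"
  shows "lam = filter_mset (\<lambda>a. 0 < a) M"
proof -
  define w where "w t = real t * (real t + 1)" for t
  have wpos: "w t > 0" if "t \<ge> 1" for t
    using that by (simp add: w_def)
  have "real (\<Sum>\<^sub># lam) = (\<Sum>t=1..T. real (part_count lam t) / w t)"
    using weighted_sum_part_count[OF lam(1)] by (simp add: w_def)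
  also have "\<dots> \<le> (\<Sum>t=1..T. real (part_count M t + e) / w t)"
    using wpos le by (intro sum_mono divide_right_mono) (auto simp: less_imp_le simp flip: of_nat_add)
  also have "\<dots> = real (\<Sum>\<^sub># M) + real e * (\<Sum>t=1..T. 1 / w t)"
    using weighted_sum_part_count[OF M] by (simp add: w_def add_divide_distrib sum.distrib sum_distrib_left)
  also have "(\<Sum>t=1..T. 1 / w t) = real T / (real T + 1)"
    unfolding w_def by (rule sum_inverse_pronic)
  finally have *: "real (\<Sum>\<^sub># lam) \<le> real (\<Sum>\<^sub># M) + real e * (real T / (real T + 1))" .
  have "real e * (real T / (real T + 1)) < real e" if "e > 0"
    using that by (simp add: field_simps)
  moreover have "real (\<Sum>\<^sub># M) + real e \<le> real (\<Sum>\<^sub># lam)"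
    using of_nat_mono[OF sum, where 'a = real] by (simp only: of_nat_add)
  ultimately have e: "e = 0"
    using * by linarith
  have diff: "real (part_count M t) / w t - real (part_count lam t) / w t \<ge> 0" if "t \<in> {1..T}" for t
    using le[OF that] wpos[of t] that e by (simp add: divide_right_mono)
  have "(\<Sum>t=1..T. real (part_count M t) / w t - real (part_count lam t) / w t)
      = real (\<Sum>\<^sub># M) - real (\<Sum>\<^sub># lam)"
    using weighted_sum_part_count[OF M] weighted_sum_part_count[OF lam(1)]
    by (simp add: w_def sum_subtractf)
  also have "\<dots> \<le> 0" using of_nat_mono[OF sum, where 'a = real] e by (simp only: of_nat_add)
  finally have "(\<Sum>t=1..T. real (part_count M t) / w t - real (part_count lam t) / w t) = 0"
    using diff by (intro antisym sum_nonneg) auto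
  then have zero: "\<forall>t\<in>{1..T}. real (part_count M t) / w t - real (part_count lam t) / w t = 0"
    using sum_nonneg_eq_0_iff[of "{1..T}", OF _ diff] by (simp only: finite_atLeastAtMost)
  have "part_count M t = part_count lam t" if "t \<in> {1..T}" for t
    using bspec[OF zero that] wpos[of t] that by simp
  then show ?thesis
    using lam M by (intro multiset_eqI_part_count[of T]) (auto simp: part_count_filter_pos)
qed

section \<open>Joins of a clique with a union of cliques\<close>

text \<open>
  The number of vertices of degree at least \<open>t\<close> in the join of \<open>K\<^sub>x\<close> with disjoint cliques
  whose sizes are the elements of \<open>B\<close>, for \<open>t\<close> below the number of vertices: a vertex
  of a clique of size \<open>s\<close> has degree \<open>x + s - 1\<close>.
\<close>

definition join_count :: "nat \<Rightarrow> nat multiset \<Rightarrow> nat \<Rightarrow> nat" where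
  "join_count x B t = x + \<Sum>\<^sub># (filter_mset (\<lambda>s. t < x + s) B)"

definition partitions :: "nat \<Rightarrow> nat multiset set" where
  "partitions r = {M. 0 \<notin># M \<and> \<Sum>\<^sub># M = r}"

text \<open>
  The size of the large clique is what the other cliques leave of the \<open>m (k + 1)\<close> vertices:
  \<open>j\<close> vertices are joined to everything, and the \<open>k j\<close> small cliques use
  \<open>k j + (k - 1)\<close> vertices, one each and a partition of \<open>k - 1\<close> on top of that.
\<close>

definition big_clique :: "nat \<Rightarrow> nat \<Rightarrow> nat \<Rightarrow> nat" where
  "big_clique k m j = (m - j) * (k + 1) - (k - 1)"

definition clique_sizes :: "nat \<Rightarrow> nat \<Rightarrow> nat \<Rightarrow> nat multiset \<Rightarrow> nat multiset" where
  "clique_sizes k m j lam = add_mset (big_clique k m j)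
     (image_mset Suc lam + replicate_mset (k * j - size lam) 1)"

lemma size_le_sum_mset: "0 \<notin># (M :: nat multiset) \<Longrightarrow> size M \<le> \<Sum>\<^sub># M"
  by (induction M) auto

lemma member_le_sum_mset: "a \<in># M \<Longrightarrow> a \<le> \<Sum>\<^sub># (M :: nat multiset)"
  by (induction M) auto

lemma sum_image_Suc: "\<Sum>\<^sub># (image_mset Suc M) = \<Sum>\<^sub># M + size M"
  by (induction M) auto

lemma big_clique_bounds:
  assumes "k \<ge> 1" "j + 2 \<le> m"
  shows "big_clique k m j \<ge> k + 3"
    and "big_clique k m j + (k - 1) + j * (k + 1) = m * (k + 1)"
proof -
  obtain d where d: "m = j + 2 + d" using assms(2) le_Suc_ex by blast
  show "big_clique k m j \<ge> k + 3"
    unfolding big_clique_def d using assms(1) by (simp add: algebra_simps)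
  show "big_clique k m j + (k - 1) + j * (k + 1) = m * (k + 1)"
    unfolding big_clique_def d using assms(1) by (simp add: algebra_simps)
qed

lemma clique_sizes_basic:
  assumes "k \<ge> 1" "1 \<le> j" "j + 2 \<le> m" "lam \<in> partitions (k - 1)"
  shows "0 \<notin># clique_sizes k m j lam" "size (clique_sizes k m j lam) = k * j + 1"
    "j + \<Sum>\<^sub># (clique_sizes k m j lam) = m * (k + 1)"
proof -
  have "size lam \<le> k - 1"
    using assms(4) size_le_sum_mset[of lam] by (auto simp: partitions_def)
  moreover have "k * 1 \<le> k * j" using assms(2) by (rule mult_le_mono2)
  ultimately have s: "size lam \<le> k * j" by linarith
  show "0 \<notin># clique_sizes k m j lam"
    using big_clique_bounds[OF assms(1,3)] by (auto simp: clique_sizes_def)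
  show "size (clique_sizes k m j lam) = k * j + 1"
    using s by (simp add: clique_sizes_def)
  show "j + \<Sum>\<^sub># (clique_sizes k m j lam) = m * (k + 1)"
    using s big_clique_bounds[OF assms(1,3)] assms(4)
    by (simp add: clique_sizes_def sum_image_Suc partitions_def algebra_simps)
qed

lemma join_count_clique_sizes:
  assumes "k \<ge> 1" "j + 2 \<le> m" "1 \<le> t" "t < k"
  shows "join_count j (clique_sizes k m j lam) (j + t) = j + big_clique k m j + part_count lam t"
proof -
  have "\<Sum>\<^sub># (filter_mset (\<lambda>s. j + t < j + s) (image_mset Suc lam)) = part_count lam t"
    by (induction lam) auto
  moreover have "filter_mset (\<lambda>s. j + t < j + s) (replicate_mset (k * j - size lam) 1) = {#}"
    using assms(3) by auto
  ultimately show ?thesis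
    using assms big_clique_bounds[OF assms(1,2)]
    by (simp add: join_count_def clique_sizes_def)
qed

text \<open>
  The rigidity of the family. Here \<open>B\<close> stands for the sizes of the components that remain after
  the deletion of a separating set of \<open>x\<close> vertices. Comparing the numbers of vertices of degree \<open>n - 1\<close> gives
  \<open>j \<le> x\<close>, as a vertex outside the separating set misses the other components. Let \<open>L\<close> be the
  size of the large clique. At least \<open>j + L\<close> vertices have degree at least \<open>j + L - 1\<close>, and these
  do not all fit into the separating set, so some component has at least \<open>j + L - x\<close>
  vertices. Together with the at least \<open>k x\<close> vertices in the other components this leaves no room
  for \<open>x > j\<close>. Once \<open>x = j\<close>, the other components have in total at most \<open>k - 1\<close>
  vertices beyond one each, and the rigidity of partitions applies to them. They are
  exactly the components of size at most \<open>k\<close>, since \<open>L > k\<close>. The second conclusion expresses \<open>lam\<close> in terms of \<open>B\<close> and \<open>k\<close> alone, so two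
  members of the family that are both below \<open>B\<close> coincide.
\<close>

lemma join_count_determines:
  fixes B lam :: "nat multiset"
  assumes k: "k \<ge> 2" and j: "1 \<le> j" "j + 2 \<le> m" and lam: "lam \<in> partitions (k - 1)"
    and B: "0 \<notin># B" "size B > 1" "size B > k * x" "x + \<Sum>\<^sub># B = m * (k + 1)"
    and le: "\<And>t. t < m * (k + 1) \<Longrightarrow> join_count j (clique_sizes k m j lam) t \<le> join_count x B t"
  shows "x = j" "lam = filter_mset (\<lambda>a. 0 < a) (image_mset (\<lambda>s. s - 1) (filter_mset (\<lambda>s. s \<le> k) B))"
proof -
  define n where "n = m * (k + 1)"
  define L where "L = big_clique k m j"
  have k1: "k \<ge> 1" using k by simp
  note L = big_clique_bounds[OF k1 j(2), folded L_def n_def]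
  have rest: "s + k * x \<le> s + \<Sum>\<^sub># (B - {#s#})" "s + \<Sum>\<^sub># (B - {#s#}) = \<Sum>\<^sub># B"
    "\<Sum>\<^sub># (B - {#s#}) \<ge> 1" if "s \<in># B" for s
  proof -
    have "0 \<notin># B - {#s#}" using B(1) by (meson in_diffD)
    then have "size (B - {#s#}) \<le> \<Sum>\<^sub># (B - {#s#})" by (rule size_le_sum_mset)
    then show "s + k * x \<le> s + \<Sum>\<^sub># (B - {#s#})" "\<Sum>\<^sub># (B - {#s#}) \<ge> 1"
      using that B by (simp_all add: size_Diff_singleton)
    show "s + \<Sum>\<^sub># (B - {#s#}) = \<Sum>\<^sub># B"
      using that by (metis insert_DiffM sum_mset.add_mset)
  qed
  have npos: "n > 0" using L by linarith
  have "x + size B \<le> n" using size_le_sum_mset[OF B(1)] B(4) by (simp add: n_def)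
  then have "x + k * x < n" using B(3) by linarith
  then have "x * (k + 1) < m * (k + 1)" by (simp add: n_def algebra_simps)
  then have xm: "x < m" by (simp only: mult_less_cancel2)
  \<comment> \<open>No component reaches degree \<open>n - 1\<close>, as there is at least one other.\<close>
  have "\<not> n - 1 < x + s" if "s \<in># B" for s
    using rest(2,3)[OF that] B(4) unfolding n_def by linarith
  then have "filter_mset (\<lambda>s. n - 1 < x + s) B = {#}" by simp
  then have "join_count x B (n - 1) = x"
    by (simp only: join_count_def sum_mset.empty add_0_right)
  moreover have "j \<le> join_count j (clique_sizes k m j lam) (n - 1)" by (simp add: join_count_def)
  ultimately have jx: "j \<le> x" using le[of "n - 1"] npos by (simp add: n_def)
  have LD: "j + L \<le> join_count j (clique_sizes k m j lam) (j + L - 1)"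
    using L by (simp add: join_count_def clique_sizes_def L_def)
  have "j + L - 1 < n" using L j by (simp add: algebra_simps)
  then have "j + L \<le> x + \<Sum>\<^sub># (filter_mset (\<lambda>s. j + L - 1 < x + s) B)"
    using LD le[of "j + L - 1"] by (simp add: n_def join_count_def)
  moreover have "x < j + L"
  proof -
    have "m * (k + 1) = m + m * k" by simp
    moreover have "m * k \<ge> (j + 2) * k" using j by (intro mult_le_mono1)
    ultimately show ?thesis using L(2) xm k1 unfolding n_def by (simp add: algebra_simps)
  qed
  ultimately have "\<Sum>\<^sub># (filter_mset (\<lambda>s. j + L - 1 < x + s) B) \<noteq> 0" by linarith
  then have "filter_mset (\<lambda>s. j + L - 1 < x + s) B \<noteq> {#}" by (metis sum_mset.empty)
  then obtain c where "c \<in># filter_mset (\<lambda>s. j + L - 1 < x + s) B"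
    by (meson multiset_nonemptyE)
  then have c: "c \<in># B" "j + L \<le> x + c" by auto
  have "x + c + k * x \<le> n" using rest[OF c(1)] B(4) by (simp add: n_def)
  with c L have "k * x < k * (j + 1)" using k1 by (simp add: algebra_simps)
  then have "x < j + 1" by (simp only: mult_less_cancel1)
  then show x: "x = j" using jx by simp
  have cL: "L \<le> c" using c x by simp
  \<comment> \<open>The surplus \<open>e\<close> of the largest component is missing from the parts \<open>M\<close> of the others.\<close>
  define e where "e = c - L"
  define B' where "B' = B - {#c#}"
  define M where "M = image_mset (\<lambda>s. s - 1) B'"
  have BB: "B = add_mset c B'" using c by (simp add: B'_def)
  have B'0: "0 \<notin># B'" using B(1) by (simp add: BB)
  have BM: "B' = image_mset Suc M"
  proof -
    have "Suc (s - 1) = s" if "s \<in># B'" for s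
      using that B'0 by (cases s) auto
    then have "image_mset (\<lambda>s. Suc (s - 1)) B' = image_mset (\<lambda>s. s) B'"
      by (intro image_mset_cong)
    then show ?thesis by (simp add: M_def multiset.map_comp comp_def)
  qed
  have szM: "size M \<ge> k * j" using B(3) x by (simp add: BB M_def)
  have "\<Sum>\<^sub># M + size M + c + j = n"
    using B(4) x by (simp add: BB BM sum_image_Suc n_def)
  then have sumM: "\<Sum>\<^sub># M + e \<le> k - 1"
    using szM L cL by (simp add: e_def algebra_simps)
  have M_le: "a \<le> \<Sum>\<^sub># M" if "a \<in># M" for a
    using that by (rule member_le_sum_mset)
  have lam_le: "a \<le> k - 1" if "a \<in># lam" for a
    using member_le_sum_mset[OF that] lam by (simp add: partitions_def)
  have pc: "part_count lam t \<le> part_count M t + e" if "t \<in> {1..k-1}" for t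
  proof -
    have "\<Sum>\<^sub># (filter_mset (\<lambda>s. j + t < j + s) (image_mset Suc M)) = part_count M t"
      by (induction M) auto
    then have "join_count j B (j + t) \<le> j + c + part_count M t"
      by (simp add: join_count_def BB BM)
    moreover have "j + t < n" using L that by (simp add: algebra_simps)
    moreover have "t < k" using that k1 by auto
    ultimately show ?thesis
      using le[of "j + t"] join_count_clique_sizes[OF k1 j(2), of t lam] that x cL
      by (simp add: n_def e_def flip: L_def)
  qed
  have "lam = filter_mset (\<lambda>a. 0 < a) M"
  proof (rule part_count_rigid[where T = "k - 1" and e = e])
    show "\<forall>a\<in>#lam. a \<le> k - 1" using lam_le by blast
    show "0 \<notin># lam" "\<Sum>\<^sub># M + e \<le> \<Sum>\<^sub># lam" using lam sumM by (simp_all add: partitions_def)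
    show "\<forall>a\<in>#M. a \<le> k - 1" using M_le sumM by (meson add_leD1 order_trans)
  qed (rule pc)
  moreover have "filter_mset (\<lambda>s. s \<le> k) B = B'"
  proof -
    have "s \<le> k" if s: "s \<in># B'" for s
    proof -
      obtain a where "s = Suc a" "a \<in># M" using s by (auto simp: BM)
      then show ?thesis using M_le[of a] sumM k1 by linarith
    qed
    then have "filter_mset (\<lambda>s. s \<le> k) B' = B'" by (simp add: filter_mset_eq_conv)
    moreover have "\<not> c \<le> k" using cL L(1) by linarith
    ultimately show ?thesis by (simp add: BB)
  qed
  ultimately show "lam = filter_mset (\<lambda>a. 0 < a) (image_mset (\<lambda>s. s - 1) (filter_mset (\<lambda>s. s \<le> k) B))"
    by (simp add: M_def)
qed

section \<open>Degree sequences and vertex counts\<close>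

lemma length_filter_degree_sequence:
  assumes "finite (pverts G)"
  shows "length (filter P (degree_sequence G)) = card {v \<in> pverts G. P (out_degree (with_proj G) v)}"
proof -
  have "length (filter P (degree_sequence G))
      = size (filter_mset P (image_mset (out_degree (with_proj G)) (mset_set (pverts G))))"
    unfolding degree_sequence_def by (simp flip: size_mset)
  also have "\<dots> = card {v \<in> pverts G. P (out_degree (with_proj G) v)}"
    using assms by (simp add: filter_mset_image_mset filter_mset_mset_set)
  finally show ?thesis .
qed

lemma length_degree_sequence: "length (degree_sequence G) = card (pverts G)"
  unfolding degree_sequence_def by (simp flip: size_mset)

lemma (in pair_graph) degree_sequence_in_nsequences:
  "degree_sequence G \<in> nsequences (card (pverts G))"
proof -
  have "out_degree G v \<le> card (pverts G) - 1" if "v \<in> pverts G" for v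
  proof -
    have "out_degree G v \<le> card (pverts G - {v})"
      unfolding out_degree_def
      using pair_finite_verts arc_snd_in_verts pair_no_loops
      by (intro card_inj_on_le[of snd]) (fastforce simp: inj_on_def prod_eq_iff)+
    then show ?thesis using that pair_finite_verts by simp
  qed
  moreover have "set (degree_sequence G) = out_degree G ` pverts G"
    using pair_finite_verts unfolding degree_sequence_def
    by (simp flip: set_mset_mset)
  moreover have "sorted (degree_sequence G)" by (simp add: degree_sequence_def)
  ultimately show ?thesis
    by (auto simp: nsequences_def length_degree_sequence)
qed

lemma majorizes_count:
  assumes "majorizes \<pi>' \<pi>"
  shows "length (filter (\<lambda>d. t \<le> d) \<pi>) \<le> length (filter (\<lambda>d. t \<le> d) \<pi>')"
  using assms unfolding majorizes_def
  by (induction rule: list_all2_induct) auto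

section \<open>Degrees in graphs that are not tough\<close>

text \<open>
  If more than \<open>k x\<close> components remain after the removal of \<open>x\<close> vertices, then adding all
  arcs inside the components and all arcs at the removed vertices lowers no degree and
  turns the graph into a join of \<open>K\<^sub>x\<close> with one clique for each component. So \<open>B\<close> consists of
  the sizes of the components.
\<close>

lemma nontough_graph_join_count:
  assumes "pair_graph G" and k: "k \<ge> 1" and nt: "\<not> tough (1 / real k) G"
  obtains x B where "0 \<notin># B" "size B > 1" "size B > k * x" "x + \<Sum>\<^sub># B = card (pverts G)"
    "\<And>t. card {v \<in> pverts G. t \<le> out_degree (with_proj G) v} \<le> join_count x B t"
proof -
  interpret pair_graph G by fact
  obtain X where X: "X \<subseteq> pverts G" and
    "num_components (with_proj G \<restriction> (pverts G - X)) > 1"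
    "\<not> 1 / real k * real (num_components (with_proj G \<restriction> (pverts G - X))) \<le> real (card X)"
    using nt unfolding tough_def Let_def by blast
  define H where "H = with_proj G \<restriction> (pverts G - X)"
  define P where "P = pre_digraph.sccs_verts H"
  have P1: "card P > 1"
    using \<open>num_components _ > 1\<close> by (simp add: P_def H_def num_components_def)
  then have finP: "finite P" by (metis card.infinite not_less_zero)
  have "real (k * card X) < real (card P)"
    using \<open>\<not> _ \<le> real (card X)\<close> k by (simp add: P_def H_def num_components_def field_simps)
  then have Pk: "card P > k * card X" by linarith
  interpret H: wf_digraph H
    unfolding H_def by (rule wellformed_induce_subgraph)
  have verts_H: "verts H = pverts G - X" by (simp add: H_def)
  have PV: "\<Union>P = pverts G - X"
    unfolding P_def H.sccs_verts_conv_scc_of using H.in_scc_of_self H.sccs_verts_subsets H.scc_of_in_sccs_verts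
    by (auto simp: verts_H)
  have fin: "finite S" if "S \<in> P" for S
  proof (rule finite_subset)
    show "S \<subseteq> pverts G" using that PV by blast
  qed (rule pair_finite_verts)
  have disj: "pairwise disjnt P"
    using H.sccs_verts_disjoint by (auto simp: pairwise_def disjnt_def P_def)
  have nonempty: "S \<noteq> {}" if "S \<in> P" for S
    using that by (auto simp: P_def H.in_sccs_verts_conv_reachable)
  have finX: "finite X" using X pair_finite_verts finite_subset by blast
  have deg: "out_degree G v < card X + card S" if "v \<in> S" "S \<in> P" for v S
  proof -
    have nbr: "w \<in> X \<union> (S - {v})" if e: "(v, w) \<in> parcs G" for w
    proof (rule ccontr)
      assume w: "w \<notin> X \<union> (S - {v})"
      have "w \<noteq> v" using e no_loops' by blast
      have "(v, w) \<in> arcs_ends H" "(w, v) \<in> arcs_ends H"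
        using e w arcs_symmetric[OF e] wellformed'[OF e] \<open>v \<in> S\<close> \<open>S \<in> P\<close> PV
        by (auto simp: H_def arcs_ends_conv image_iff)
      then have "v \<rightarrow>\<^sup>*\<^bsub>H\<^esub> w" "w \<rightarrow>\<^sup>*\<^bsub>H\<^esub> v" by auto
      with w \<open>w \<noteq> v\<close> \<open>v \<in> S\<close> \<open>S \<in> P\<close> show False
        by (auto simp: P_def H.in_sccs_verts_conv_reachable)
    qed
    have "out_degree G v \<le> card (X \<union> (S - {v}))"
      unfolding out_degree_def using finX fin[OF \<open>S \<in> P\<close>]
      by (intro card_inj_on_le[of snd]) (use nbr in \<open>force simp: inj_on_def\<close>)+
    also have "\<dots> \<le> card X + card (S - {v})" by (rule card_Un_le)
    also have "\<dots> < card X + card S"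
      using \<open>v \<in> S\<close> fin[OF \<open>S \<in> P\<close>] by (intro add_strict_left_mono card_Diff1_less)
    finally show ?thesis .
  qed
  define B where "B = image_mset card (mset_set P)"
  show ?thesis
  proof (rule that[of B "card X"])
    show "0 \<notin># B" using nonempty fin finP by (auto simp: B_def)
    show "size B > 1" "size B > k * card X" using P1 Pk by (simp_all add: B_def)
    have "\<Sum>\<^sub># B = card (\<Union>P)"
      using card_Union_disjoint[OF disj fin] by (simp add: B_def sum_unfold_sum_mset)
    then show "card X + \<Sum>\<^sub># B = card (pverts G)"
      using PV X finX pair_finite_verts card_mono[of "pverts G" X] by (simp add: card_Diff_subset)
    fix t
    define Q where "Q = {S \<in> P. t < card X + card S}"
    have "{v \<in> pverts G. t \<le> out_degree G v} \<subseteq> X \<union> \<Union>Q"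
    proof
      fix v assume v: "v \<in> {v \<in> pverts G. t \<le> out_degree G v}"
      show "v \<in> X \<union> \<Union>Q"
      proof (cases "v \<in> X")
        case False
        then obtain S where S: "v \<in> S" "S \<in> P" using v PV by blast
        then have "t < card X + card S" using deg[OF S] v by simp
        then show ?thesis using S by (auto simp: Q_def)
      qed simp
    qed
    then have "card {v \<in> pverts G. t \<le> out_degree G v} \<le> card (X \<union> \<Union>Q)"
      using finX finP fin by (intro card_mono) (auto simp: Q_def)
    also have "\<dots> \<le> card X + card (\<Union>Q)" by (rule card_Un_le)
    also have "card (\<Union>Q) \<le> (\<Sum>S\<in>Q. card S)"
      by (rule card_Union_le_sum_card)
    also have "(\<Sum>S\<in>Q. card S) = \<Sum>\<^sub># (filter_mset (\<lambda>s. t < card X + s) B)"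
      using finP by (simp add: B_def Q_def sum_unfold_sum_mset filter_mset_image_mset filter_mset_mset_set)
    finally show "card {v \<in> pverts G. t \<le> out_degree (with_proj G) v} \<le> join_count (card X) B t"
      by (simp add: join_count_def)
  qed
qed

text \<open>
  Conversely, every join of \<open>K\<^sub>j\<close> with more than \<open>k j\<close> cliques fails to be \<open>1 / k\<close>-tough. Its
  vertices are the codes of pairs \<open>(i, a)\<close>, where \<open>i\<close> names the clique and \<open>i = 0\<close> stands for \<open>K\<^sub>j\<close>.
  The vertices with label \<open>i\<close> form the set \<open>F i\<close>, and without \<open>F 0\<close> no arc changes the label.
\<close>

lemma nontough_graph_exists:
  assumes "0 \<notin># D" "size D > 1" "size D > k * j" and k: "k \<ge> 1"
  obtains G :: "nat pair_pre_digraph" where "pair_graph G" "\<not> tough (1 / real k) G"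
    "card (pverts G) = j + \<Sum>\<^sub># D"
    "\<And>t. t < j + \<Sum>\<^sub># D \<Longrightarrow> join_count j D t \<le> card {v \<in> pverts G. t \<le> out_degree (with_proj G) v}"
proof -
  obtain ss where ss: "mset ss = D" using ex_mset by blast
  define q where "q = length ss"
  define F where "F i = (\<lambda>a. prod_encode (i, a)) ` {..<(j # ss) ! i}" for i
  define lab where "lab v = fst (prod_decode v)" for v
  define V where "V = (\<Union>i\<le>q. F i)"
  define G where "G = \<lparr>pverts = V,
    parcs = {(u, v). u \<in> V \<and> v \<in> V \<and> u \<noteq> v \<and> (lab u = 0 \<or> lab v = 0 \<or> lab u = lab v)}\<rparr>"
  have finF: "finite (F i)" for i by (simp add: F_def)
  have cardF: "card (F i) = (j # ss) ! i" for i
    unfolding F_def by (subst card_image) (auto simp: inj_on_def)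
  have labF: "v \<in> F i \<Longrightarrow> lab v = i" for v i by (auto simp: F_def lab_def)
  have disjF: "F i \<inter> F i' = {}" if "i \<noteq> i'" for i i' using that labF by blast
  have finV: "finite V" by (simp add: V_def finF)
  have G_simps: "pverts G = V"
    "parcs G = {(u, v). u \<in> V \<and> v \<in> V \<and> u \<noteq> v \<and> (lab u = 0 \<or> lab v = 0 \<or> lab u = lab v)}"
    by (simp_all add: G_def)
  interpret G: pair_graph G
  proof
    show "finite (parcs G)"
      by (rule finite_subset[of _ "V \<times> V"]) (auto simp: G_simps finV)
    show "symmetric (with_proj G)"
      by (auto simp: symmetric_def sym_def G_simps)
  qed (auto simp: G_simps finV)
  have nth_pos: "(j # ss) ! i > 0" if i: "1 \<le> i" "i \<le> q" for i
  proof -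
    obtain i' where i': "i = Suc i'" using i(1) by (cases i) auto
    then have "ss ! i' \<in># D" using i(2) by (auto simp: q_def simp flip: ss)
    then show ?thesis using assms(1) i' by (metis gr0I nth_Cons_Suc)
  qed
  have sum_ss: "(\<Sum>i\<in>{1..q}. f ((j # ss) ! i)) = \<Sum>\<^sub># (image_mset f D)" for f :: "nat \<Rightarrow> nat"
  proof -
    have "(\<Sum>i\<in>{1..q}. f ((j # ss) ! i)) = (\<Sum>i<q. f (ss ! i))"
      by (rule sum.reindex_bij_witness[of _ Suc "\<lambda>i. i - 1"]) auto
    also have "\<dots> = sum_list (map f ss)"
      by (simp add: sum_list_sum_nth q_def atLeast0LessThan)
    finally show ?thesis by (metis mset_map ss sum_mset_sum_list)
  qed
  have card_union: "card (F 0 \<union> (\<Union>i\<in>I. F i)) = j + (\<Sum>i\<in>I. (j # ss) ! i)" if "I \<subseteq> {1..q}" for I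
  proof -
    have I: "finite I" "0 \<notin> I" using that finite_subset by auto
    have "card (\<Union>i\<in>insert 0 I. F i) = (\<Sum>i\<in>insert 0 I. card (F i))"
      using I finF disjF by (intro card_UN_disjoint) auto
    then show ?thesis using I by (simp add: cardF)
  qed
  have "V = F 0 \<union> (\<Union>i\<in>{1..q}. F i)"
    by (auto simp: V_def) (metis One_nat_def atLeastAtMost_iff le_0_eq not_less_eq_eq)
  then have cardV: "card V = j + \<Sum>\<^sub># D"
    using card_union[of "{1..q}"] sum_ss[of "\<lambda>s. s"] by simp
  have deg: "card W \<le> Suc (out_degree G v)"
    if "v \<in> V" "W \<subseteq> V" "\<forall>w\<in>W. lab v = 0 \<or> lab w = 0 \<or> lab v = lab w" for v W
  proof -
    have "card (W - {v}) \<le> out_degree G v"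
      unfolding out_degree_def using that finV
      by (intro card_inj_on_le[of "\<lambda>w. (v, w)"])
         (auto simp: inj_on_def out_arcs_def G_simps intro: finite_subset[of _ "V \<times> V"])
    then show ?thesis by (simp add: card_Diff_singleton_if split: if_splits)
  qed
  show ?thesis
  proof (rule that[of G])
    show "pair_graph G" ..
    show "card (pverts G) = j + \<Sum>\<^sub># D" by (simp add: G_simps cardV)
    show "\<not> tough (1 / real k) G"
    proof -
      define H where "H = with_proj G \<restriction> (pverts G - F 0)"
      interpret H: wf_digraph H
        unfolding H_def by (rule G.wellformed_induce_subgraph)
      interpret H: fin_digraph H
        by unfold_locales (auto simp: H_def G.pair_finite_verts G.pair_finite_arcs)
      have lab_reach: "lab u = lab v" if "u \<rightarrow>\<^sup>*\<^bsub>H\<^esub> v" for u v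
        using that
      proof (induction rule: H.reachable_induct)
        case (step x y)
        then have "x \<in> V - F 0" "y \<in> V - F 0" "lab x = 0 \<or> lab y = 0 \<or> lab x = lab y"
          by (auto simp: H_def arcs_ends_conv G_simps)
        then show ?case using step labF by (auto simp: V_def)
      qed simp
      have "\<exists>r. r \<in> F i" if "i \<in> {1..q}" for i
        using nth_pos[of i] that by (auto simp: F_def)
      then obtain r where r: "\<And>i. i \<in> {1..q} \<Longrightarrow> r i \<in> F i" by metis
      have rV: "r i \<in> verts H" if "i \<in> {1..q}" for i
        using r[OF that] that labF[OF r[OF that]] by (auto simp: H_def G_simps V_def dest: labF)
      have "inj_on (\<lambda>i. H.scc_of (r i)) {1..q}"
      proof (rule inj_onI)
        fix a b assume ab: "a \<in> {1..q}" "b \<in> {1..q}" "H.scc_of (r a) = H.scc_of (r b)"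
        then have "r b \<in> H.scc_of (r a)" using rV H.in_scc_of_self by metis
        then have "lab (r a) = lab (r b)" using lab_reach by (auto simp: H.scc_of_def)
        then show "a = b" using r ab labF by metis
      qed
      then have "card {1..q} \<le> card H.sccs_verts"
        using rV H.scc_of_in_sccs_verts H.finite_sccs_verts by (intro card_inj_on_le) auto
      then have "size D \<le> num_components H" by (simp add: num_components_def q_def flip: ss)
      moreover have "real (k * card (F 0)) < real (num_components H)"
        using calculation assms(3) by (simp add: cardF flip: of_nat_mult)
      ultimately have "num_components H > 1"
        "\<not> 1 / real k * real (num_components H) \<le> real (card (F 0))"
        using assms(2) k by (simp_all add: field_simps)
      moreover have "F 0 \<subseteq> pverts G" by (auto simp: G_simps V_def)
      ultimately show ?thesis unfolding tough_def H_def Let_def by blast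
    qed
    fix t assume t: "t < j + \<Sum>\<^sub># D"
    define I where "I = {i \<in> {1..q}. t < j + (j # ss) ! i}"
    have I_sub: "I \<subseteq> {1..q}" by (auto simp: I_def)
    have "(\<Sum>i\<in>I. (j # ss) ! i) = (\<Sum>i\<in>{1..q}. if t < j + (j # ss) ! i then (j # ss) ! i else 0)"
      unfolding I_def by (subst sum.inter_filter) auto
    also have "\<dots> = \<Sum>\<^sub># (image_mset (\<lambda>s. if t < j + s then s else 0) D)"
      by (rule sum_ss)
    also have "\<dots> = \<Sum>\<^sub># (filter_mset (\<lambda>s. t < j + s) D)"
      by (induction D) auto
    finally have "join_count j D t = card (F 0 \<union> (\<Union>i\<in>I. F i))"
      using card_union[of I] I_sub by (simp add: join_count_def)
    also have "\<dots> \<le> card {v \<in> pverts G. t \<le> out_degree G v}"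
    proof (rule card_mono)
      show "finite {v \<in> pverts G. t \<le> out_degree G v}" by (simp add: G_simps finV)
      have "t \<le> out_degree G v" if "v \<in> F 0" for v
      proof -
        have "card V \<le> Suc (out_degree G v)"
          using that labF[OF that] by (intro deg) (auto simp: V_def)
        then show ?thesis using t by (simp add: cardV)
      qed
      moreover have "t \<le> out_degree G v" if "i \<in> I" "v \<in> F i" for i v
      proof -
        have "i \<in> {1..q}" using that by (simp add: I_def)
        then have "card (F 0 \<union> F i) = j + (j # ss) ! i" using card_union[of "{i}"] by simp
        moreover have "card (F 0 \<union> F i) \<le> Suc (out_degree G v)"
          using that labF \<open>i \<in> {1..q}\<close> by (intro deg) (auto simp: V_def)
        moreover have "t < j + (j # ss) ! i" using that unfolding I_def by blast
        ultimately show ?thesis by linarith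
      qed
      ultimately show "F 0 \<union> (\<Union>i\<in>I. F i) \<subseteq> {v \<in> pverts G. t \<le> out_degree G v}"
        by (auto simp: G_simps V_def I_def)
    qed
    finally show "join_count j D t \<le> card {v \<in> pverts G. t \<le> out_degree (with_proj G) v}" .
  qed
qed

section \<open>Termwise maxima of sequences\<close>

definition seq_max :: "nat list \<Rightarrow> nat list \<Rightarrow> nat list" where
  "seq_max \<pi> \<rho> = map2 max \<pi> \<rho>"

lemma seq_max_in_nsequences:
  assumes "\<pi> \<in> nsequences n" "\<rho> \<in> nsequences n"
  shows "seq_max \<pi> \<rho> \<in> nsequences n"
proof -
  have len: "length \<pi> = n" "length \<rho> = n" using assms by (auto simp: nsequences_def)
  have "max (\<pi> ! i) (\<rho> ! i) \<le> max (\<pi> ! i') (\<rho> ! i')" if "i \<le> i'" "i' < n" for i i'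
    using assms that by (intro max.mono) (auto simp: nsequences_def sorted_iff_nth_mono)
  moreover have "max (\<pi> ! i) (\<rho> ! i) \<le> n - 1" if "i < n" for i
    using assms that by (auto simp: nsequences_def)
  ultimately show ?thesis
    using len by (auto simp: nsequences_def seq_max_def sorted_iff_nth_mono all_set_conv_all_nth)
qed

lemma seq_max_not_satisfies:
  assumes "c \<in> chvatal_conditions n" "\<pi> \<in> nsequences n" "\<rho> \<in> nsequences n"
    "\<not> satisfies \<pi> c" "\<not> satisfies \<rho> c"
  shows "\<not> satisfies (seq_max \<pi> \<rho>) c"
proof -
  have "\<not> k \<le> seq_max \<pi> \<rho> ! (i - 1)" if "(i, k) \<in> set c" for i k
  proof -
    have "i - 1 < n" "\<not> k \<le> \<pi> ! (i - 1)" "\<not> k \<le> \<rho> ! (i - 1)"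
      using assms that by (auto simp: chvatal_conditions_def satisfies_def)
    then show ?thesis
      using assms(2,3) by (auto simp: seq_max_def nsequences_def)
  qed
  then show ?thesis by (auto simp: satisfies_def)
qed

lemma majorizes_seq_maxD:
  assumes "\<pi> \<in> nsequences n" "\<rho> \<in> nsequences n" "majorizes \<sigma> (seq_max \<pi> \<rho>)"
  shows "majorizes \<sigma> \<pi>" "majorizes \<sigma> \<rho>"
proof -
  have len: "length \<pi> = n" "length \<rho> = n" using assms by (auto simp: nsequences_def)
  then have max: "length \<sigma> = n" "\<forall>i<n. max (\<pi> ! i) (\<rho> ! i) \<le> \<sigma> ! i"
    using assms(3) by (simp_all add: majorizes_def seq_max_def list_all2_conv_all_nth)
  show "majorizes \<sigma> \<pi>" "majorizes \<sigma> \<rho>"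
    using max len by (simp_all add: majorizes_def list_all2_conv_all_nth)
qed

section \<open>Counting the conditions\<close>

text \<open>
  \<open>\<pi>\<close> has, in terms of vertex counts, at least the degrees of the join for \<open>j\<close> and \<open>lam\<close>. Unlike
  equality with the degree sequence of the join, this is inherited by every sequence that
  majorizes \<open>\<pi>\<close>, and it is all that rigidity requires.
\<close>

definition above_join :: "nat \<Rightarrow> nat \<Rightarrow> nat \<Rightarrow> nat multiset \<Rightarrow> nat list \<Rightarrow> bool" where
  "above_join k m j lam \<pi> \<longleftrightarrow> (\<forall>t < m * (k + 1).
     join_count j (clique_sizes k m j lam) t \<le> length (filter (\<lambda>d. t \<le> d) \<pi>))"

lemma nontough_sequence_of_partition:
  assumes k: "k \<ge> 2" and j: "1 \<le> j" "j + 2 \<le> m" and lam: "lam \<in> partitions (k - 1)"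
  shows "\<exists>\<pi> \<in> nsequences (m * (k + 1)).
    graphical \<pi> \<and> \<not> forcibly_tough (1 / real k) \<pi> \<and> above_join k m j lam \<pi>"
proof -
  have k1: "k \<ge> 1" using k by simp
  note D = clique_sizes_basic[OF k1 j lam]
  have "1 * 1 \<le> k * j" using k1 j(1) by (rule mult_le_mono)
  then have "size (clique_sizes k m j lam) > 1" using D(2) by linarith
  moreover have "size (clique_sizes k m j lam) > k * j" using D(2) by simp
  ultimately obtain G :: "nat pair_pre_digraph" where G: "pair_graph G" "\<not> tough (1 / real k) G"
    "card (pverts G) = j + \<Sum>\<^sub># (clique_sizes k m j lam)"
    "\<And>t. t < j + \<Sum>\<^sub># (clique_sizes k m j lam) \<Longrightarrow> join_count j (clique_sizes k m j lam) t
      \<le> card {v \<in> pverts G. t \<le> out_degree (with_proj G) v}"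
    using nontough_graph_exists[OF D(1) _ _ k1] by blast
  interpret pair_graph G by fact
  have real: "realizes G (degree_sequence G)"
    using G(1) by (simp add: realizes_def)
  show ?thesis
  proof (intro bexI conjI)
    show "degree_sequence G \<in> nsequences (m * (k + 1))"
      using degree_sequence_in_nsequences G(3) D(3) by simp
    show "graphical (degree_sequence G)" using real by (auto simp: graphical_def)
    show "\<not> forcibly_tough (1 / real k) (degree_sequence G)"
      using real G(2) by (auto simp: forcibly_tough_def)
    show "above_join k m j lam (degree_sequence G)"
      unfolding above_join_def length_filter_degree_sequence[OF pair_finite_verts] using G(4) D(3) by simp
  qed
qed

text \<open>
  Both indices can be read off one realization of \<open>\<sigma>\<close> together with one set that
  separates it, so they agree.
\<close>

lemma majorized_by_nontough_determines:
  assumes k: "k \<ge> 2"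
    and \<sigma>: "\<not> forcibly_tough (1 / real k) \<sigma>" "length \<sigma> = m * (k + 1)"
    and \<pi>: "majorizes \<sigma> \<pi>" "above_join k m j lam \<pi>"
      "1 \<le> j" "j + 2 \<le> m" "lam \<in> partitions (k - 1)"
    and \<pi>': "majorizes \<sigma> \<pi>'" "above_join k m j' lam' \<pi>'"
      "1 \<le> j'" "j' + 2 \<le> m" "lam' \<in> partitions (k - 1)"
  shows "j = j' \<and> lam = lam'"
proof -
  obtain G :: "nat pair_pre_digraph" where G: "pair_graph G" "degree_sequence G = \<sigma>" "\<not> tough (1 / real k) G"
    using \<sigma>(1) unfolding forcibly_tough_def realizes_def by metis
  interpret pair_graph G by fact
  have k1: "k \<ge> 1" using k by simp
  obtain x B where B: "0 \<notin># B" "size B > 1" "size B > k * x" "x + \<Sum>\<^sub># B = card (pverts G)"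
    "\<And>t. card {v \<in> pverts G. t \<le> out_degree (with_proj G) v} \<le> join_count x B t"
    using nontough_graph_join_count[OF G(1) k1 G(3)] by blast
  have card: "card (pverts G) = m * (k + 1)"
    using \<sigma>(2) G(2) length_degree_sequence by metis
  have cnt: "length (filter (\<lambda>d. t \<le> d) \<sigma>) \<le> join_count x B t" for t
    using B(5)[of t] length_filter_degree_sequence[OF pair_finite_verts, of "\<lambda>d. t \<le> d"] G(2) by simp
  have "i = x \<and> M = filter_mset (\<lambda>a. 0 < a)
      (image_mset (\<lambda>s. s - 1) (filter_mset (\<lambda>s. s \<le> k) B))"
    if *: "1 \<le> i" "i + 2 \<le> m" "M \<in> partitions (k - 1)"
      and \<rho>: "majorizes \<sigma> \<rho>" "above_join k m i M \<rho>" for i M \<rho>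
  proof -
    have "join_count i (clique_sizes k m i M) t \<le> join_count x B t" if "t < m * (k + 1)" for t
      using \<rho>(2) that majorizes_count[OF \<rho>(1), of t] cnt[of t]
      unfolding above_join_def by (meson order_trans)
    from join_count_determines[OF k * B(1-3) B(4)[unfolded card] this]
    show ?thesis by simp
  qed
  from this[OF \<pi>(3-5) \<pi>(1,2)] this[OF \<pi>'(3-5) \<pi>'(1,2)] show ?thesis by simp
qed

theorem theorem4p2:
  fixes k m n :: nat and C :: "degree_condition set"
  assumes "k \<ge> 2" and "m \<ge> 9" and "n = m * (k + 1)"
    and "C \<subseteq> chvatal_conditions n"
    and "\<And>c. c \<in> C \<Longrightarrow> weakly_optimal_condition (1 / real k) n c"
    and "best_monotone_theorem (1 / real k) n (declared_by n C)"
  shows "real (card C) \<ge> real (num_partitions (k - 1)) * real n / (5 * (real k + 1))"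
proof -
  define I where "I = {1..m - 2} \<times> partitions (k - 1)"
  have I: "1 \<le> fst p" "fst p + 2 \<le> m" "snd p \<in> partitions (k - 1)" if "p \<in> I" for p
    using that assms(2) by (auto simp: I_def)
  have "\<exists>\<pi> c. \<pi> \<in> nsequences n \<and> above_join k m (fst p) (snd p) \<pi> \<and> c \<in> C \<and> \<not> satisfies \<pi> c"
    if p: "p \<in> I" for p
  proof -
    obtain \<pi> where \<pi>: "\<pi> \<in> nsequences n" "graphical \<pi>" "\<not> forcibly_tough (1 / real k) \<pi>"
      "above_join k m (fst p) (snd p) \<pi>"
      using nontough_sequence_of_partition[OF assms(1) I[OF p]] unfolding assms(3) by blast
    then have "\<pi> \<notin> declared_by n C"
      using assms(6) by (auto simp: best_monotone_theorem_def tough_theorem_def)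
    then show ?thesis using \<pi> by (auto simp: declared_by_def)
  qed
  then obtain \<pi> c where \<pi>: "\<And>p. p \<in> I \<Longrightarrow> \<pi> p \<in> nsequences n"
      "\<And>p. p \<in> I \<Longrightarrow> above_join k m (fst p) (snd p) (\<pi> p)"
    and c: "\<And>p. p \<in> I \<Longrightarrow> c p \<in> C" "\<And>p. p \<in> I \<Longrightarrow> \<not> satisfies (\<pi> p) (c p)"
    by metis
  have "inj_on c I"
  proof (rule inj_onI)
    fix p q assume pq: "p \<in> I" "q \<in> I" "c p = c q"
    define \<mu> where "\<mu> = seq_max (\<pi> p) (\<pi> q)"
    have \<mu>: "\<mu> \<in> nsequences n" unfolding \<mu>_def by (intro seq_max_in_nsequences \<pi> pq)
    have "\<not> satisfies (\<pi> q) (c p)" using c(2)[OF pq(2)] pq(3) by simp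
    then have "\<not> satisfies \<mu> (c p)"
      unfolding \<mu>_def using seq_max_not_satisfies \<pi>(1) pq c assms(4) by blast
    then have "majorized_by_nontough (1 / real k) \<mu>"
      using assms(5)[OF c(1)[OF pq(1)]] \<mu> unfolding weakly_optimal_condition_def by blast
    then obtain \<sigma> where \<sigma>: "\<not> forcibly_tough (1 / real k) \<sigma>" "majorizes \<sigma> \<mu>"
      unfolding majorized_by_nontough_def by blast
    have "length \<sigma> = m * (k + 1)"
      using \<sigma>(2) \<mu> assms(3)
      by (auto simp: majorizes_def nsequences_def dest: list_all2_lengthD)
    moreover have "majorizes \<sigma> (\<pi> p)" "majorizes \<sigma> (\<pi> q)"
      using majorizes_seq_maxD[OF \<pi>(1)[OF pq(1)] \<pi>(1)[OF pq(2)]] \<sigma>(2) by (simp_all add: \<mu>_def)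
    ultimately have "fst p = fst q \<and> snd p = snd q"
      using majorized_by_nontough_determines[OF assms(1) \<sigma>(1)] \<pi>(2) I pq(1,2) by metis
    then show "p = q" by (simp add: prod_eq_iff)
  qed
  moreover have "finite C" using assms(4) finite_chvatal_conditions finite_subset by blast
  ultimately have "card I \<le> card C" using c(1) by (intro card_inj_on_le) auto
  moreover have "card I = (m - 2) * num_partitions (k - 1)"
    by (simp add: I_def card_cartesian_product num_partitions_def partitions_def)
  ultimately have "real ((m - 2) * num_partitions (k - 1)) \<le> real (card C)"
    by (simp only: of_nat_le_iff)
  moreover have "real (num_partitions (k - 1)) * (real m / 5) \<le> real (num_partitions (k - 1)) * real (m - 2)"
    using assms(2) by (intro mult_left_mono) auto
  moreover have "real (num_partitions (k - 1)) * real n / (5 * (real k + 1))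
      = real (num_partitions (k - 1)) * (real m / 5)"
  proof -
    have "real n = real m * (real k + 1)" using assms(3) by (simp add: algebra_simps)
    moreover have "real k + 1 \<noteq> 0" by linarith
    ultimately show ?thesis by (simp add: divide_simps)
  qed
  ultimately show ?thesis by (simp add: mult.commute)
qed

end
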